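(* Let $\mathcal{S}$ be a nonempty set with a scene space basis $\mathcal{B}$ and let $P$ be a program over $\mathcal{S}$. Then $BV(P)$ is the smallest set of variables satisfying the bound effect property for $P$. That is: (1) for all $s,s'\in\mathcal{S}$, $P(s,s')$ implies $s\approx s'$ on $(\bigcup BV(P))^{\complement}$; and (2) if $T\subseteq\mathcal{B}$ is such that for all $s,s'\in\mathcal{S}$, $P(s,s')$ implies $s\approx s'$ on $(\bigcup T)^{\complement}$, then $BV(P)\subseteq T$.
   Context: Scenes. Let $\mathcal{S}$ be a nonempty set (of states). A scene on $\mathcal{S}$ is a function $A:\mathcal{S}\to\mathcal{S}\to\mathcal{S}$ satisfying for all $x,y,z$: $A\,(A\,x\,y)\,z = A\,x\,z$, $A\,x\,(A\,y\,z)=A\,x\,z$, $A\,x\,x=x$. Write $\bot = (\lambda s_1\,s_2.\ s_1)$, $\top=(\lambda s_1\,s_2.\ s_2)$, $A^{\complement}=(\lambda s_1\,s_2.\ A\,s_2\,s_1)$, $A\sqcup B=(\lambda s_1\,s_2.\ B\,(A\,s_1\,s_2)\,s_2)$. Scenes $A,B$ are independent if $B\,(A\,s_1\,s_2)\,s_3=A\,(B\,s_1\,s_3)\,s_2$ for all $s_1,s_2,s_3$. Write "$s_1\approx s_2$ on $A$" for $A\,s_1\,s_2=s_1$. A scene space basis is a finite sequence of scenes $S_1,\dots,S_n$ with $S_i,S_j$ independent for $i\neq j$ and $S_1\sqcup\cdots\sqcup S_n=\top$; $\mathcal{B}=\{S_1,\dots,S_n\}$ (the variables). For a set $X\subseteq\mathcal{B}$,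 $\bigcup X$ denotes the $\sqcup$ of all its elements (in any order, the result being independent of it), with $\bigcup\emptyset=\bot$. A program is a binary predicate $P(s,s')$ on $\mathcal{S}$. Bound variables: $BV(P)=\{x\in\mathcal{B} : \exists s_0,s_0'.\ P(s_0,s_0') \text{ and not } (s_0\approx s_0' \text{ on } x)\}$. *)

theory Defs
  imports Main
begin

text \<open>The nonempty set of states is the type \<open>'s\<close>; all HOL types are nonempty.\<close>

type_synonym 's merge = "'s \<Rightarrow> 's \<Rightarrow> 's"

definition scene :: "'s merge \<Rightarrow> bool" where
  "scene A \<longleftrightarrow>
     (\<forall>x y z. A (A x y) z = A x z) \<and>
     (\<forall>x y z. A x (A y z) = A x z) \<and>
     (\<forall>x. A x x = x)"

definition scene_bot :: "'s merge" where
  "scene_bot = (\<lambda>s\<^sub>1 s\<^sub>2. s\<^sub>1)"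

definition scene_top :: "'s merge" where
  "scene_top = (\<lambda>s\<^sub>1 s\<^sub>2. s\<^sub>2)"

definition scene_compl :: "'s merge \<Rightarrow> 's merge" where
  "scene_compl A = (\<lambda>s\<^sub>1 s\<^sub>2. A s\<^sub>2 s\<^sub>1)"

definition scene_join :: "'s merge \<Rightarrow> 's merge \<Rightarrow> 's merge" where
  "scene_join A B = (\<lambda>s\<^sub>1 s\<^sub>2. B (A s\<^sub>1 s\<^sub>2) s\<^sub>2)"

definition scene_indep :: "'s merge \<Rightarrow> 's merge \<Rightarrow> bool" where
  "scene_indep A B \<longleftrightarrow> (\<forall>s\<^sub>1 s\<^sub>2 s\<^sub>3. B (A s\<^sub>1 s\<^sub>2) s\<^sub>3 = A (B s\<^sub>1 s\<^sub>3) s\<^sub>2)"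

definition agree_on :: "'s \<Rightarrow> 's \<Rightarrow> 's merge \<Rightarrow> bool"
    (\<open>(_ \<approx> _ on _)\<close> [51, 51, 51] 50) where
  "s\<^sub>1 \<approx> s\<^sub>2 on A \<longleftrightarrow> A s\<^sub>1 s\<^sub>2 = s\<^sub>1"

text \<open>
  Independence is required of distinct positions, not distinct values, so only
  \<^const>\<open>scene_bot\<close> can occur more than once.  Since \<^const>\<open>scene_join\<close> is
  associative with unit \<^const>\<open>scene_bot\<close>, the \<^const>\<open>foldr\<close> below is the join of
  the sequence in the given order.  The variables are the elements of \<open>set S\<close>.
\<close>

definition scene_basis :: "'s merge list \<Rightarrow> bool" where
  "scene_basis S \<longleftrightarrow>
     (\<forall>A \<in> set S. scene A) \<and>
     (\<forall>i < length S. \<forall>j < length S. i \<noteq> j \<longrightarrow> scene_indep (S ! i) (S ! j)) \<and>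
     foldr scene_join S scene_bot = scene_top"

text \<open>
  The join of a finite set of scenes.  It is used only for sets of variables, where the
  order of the elements is irrelevant: see \<open>scene_Join_eq_foldr\<close>.
\<close>

definition scene_Join :: "'s merge set \<Rightarrow> 's merge" where
  "scene_Join X = Finite_Set.fold scene_join scene_bot X"

lemma scene_join_assoc:
  "scene_join (scene_join A B) C = scene_join A (scene_join B C)"
  by (simp add: scene_join_def)

lemma scene_join_bot [simp]:
  "scene_join scene_bot A = A" "scene_join A scene_bot = A"
  by (simp_all add: scene_join_def scene_bot_def)

lemma scene_join_commute_on_basis:
  assumes "scene_basis S"
  shows "comp_fun_commute_on (set S) scene_join"
proof
  fix A B assume "A \<in> set S" "B \<in> set S"
  then have "A = B \<or> scene_indep A B"
    using assms unfolding scene_basis_def by (metis in_set_conv_nth)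
  then show "scene_join B \<circ> scene_join A = scene_join A \<circ> scene_join B"
    by (auto simp: fun_eq_iff scene_join_def scene_indep_def)
qed

lemma scene_Join_eq_foldr:
  assumes "scene_basis S" "set xs \<subseteq> set S" "distinct xs"
  shows "scene_Join (set xs) = foldr scene_join xs scene_bot"
  using assms(2,3)
proof (induction xs)
  case Nil
  show ?case by (simp add: scene_Join_def)
next
  case (Cons A xs)
  interpret comp_fun_commute_on "set S" scene_join
    by (rule scene_join_commute_on_basis [OF assms(1)])
  show ?case
    using Cons by (simp add: scene_Join_def)
qed

definition bound_vars :: "'s merge list \<Rightarrow> ('s \<Rightarrow> 's \<Rightarrow> bool) \<Rightarrow> 's merge set" where
  "bound_vars S P = {x \<in> set S. \<exists>s\<^sub>0 s\<^sub>0'. P s\<^sub>0 s\<^sub>0' \<and> \<not> (s\<^sub>0 \<approx> s\<^sub>0' on x)}"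

end

theory Submission
  imports Defs
begin

text \<open>
  If \<open>P s s'\<close>, then \<open>s\<close> and \<open>s'\<close> agree on every variable outside \<^term>\<open>bound_vars S P\<close>.  Hence these
  variables may be added to the join of the bound ones without changing its value at \<open>s' s\<close>, and
  the join of all variables is \<^const>\<open>scene_top\<close>.  Conversely, a variable \<open>x\<close> outside \<open>T\<close> commutes
  with the join of \<open>T\<close>, so \<open>\<Union>T s' s = s\<close> gives \<open>x s s' = \<Union>T (x s' s') s = \<Union>T s' s = s\<close>.
\<close>

text \<open>Substituting \<open>s = A s s'\<close> gives
  \<open>A s' s = A s' (A s s') = A s' s' = s'\<close>.\<close>

lemma agree_on_sym:
  assumes "scene A" "s \<approx> s' on A"
  shows "s' \<approx> s on A"
  using assms unfolding scene_def agree_on_def by metis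

lemma scene_basis_indep:
  assumes "scene_basis S" "A \<in> set S" "B \<in> set S" "A \<noteq> B"
  shows "scene_indep A B"
  using assms unfolding scene_basis_def by (metis in_set_conv_nth)

lemma scene_Join_empty [simp]: "scene_Join {} = scene_bot"
  by (simp add: scene_Join_def)

text \<open>Scenes are idempotent under \<open>scene_join\<close>, so a repeated \<open>A\<close> is
  absorbed and no freshness condition is needed.\<close>

lemma scene_Join_insert:
  assumes "scene_basis S" "A \<in> set S" "X \<subseteq> set S"
  shows "scene_Join (insert A X) = scene_join A (scene_Join X)"
proof -
  interpret comp_fun_commute_on "set S" scene_join
    by (rule scene_join_commute_on_basis [OF assms(1)])
  interpret comp_fun_idem_on "set S" scene_join
  proof
    fix B assume "B \<in> set S"
    then have "scene B"
      using assms(1) by (simp add: scene_basis_def)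
    then show "scene_join B \<circ> scene_join B = scene_join B"
      by (simp add: fun_eq_iff scene_join_def scene_def)
  qed
  have "finite X"
    using assms(3) finite_subset by blast
  then show ?thesis
    using assms by (simp add: scene_Join_def fold_insert_idem)
qed

text \<open>\<open>S\<close> may repeat \<open>scene_bot\<close>, so
  \<open>scene_Join_eq_foldr\<close>, which asks for distinctness, does not apply; the idempotent
  insertion rule does.\<close>

lemma scene_Join_basis:
  assumes "scene_basis S"
  shows "scene_Join (set S) = scene_top"
proof -
  have "scene_Join (set xs) = foldr scene_join xs scene_bot" if "set xs \<subseteq> set S" for xs
    using that by (induction xs) (simp_all add: scene_Join_insert [OF assms])
  then show ?thesis
    using assms by (simp add: scene_basis_def)
qed

text \<open>Each \<open>A\<close> from \<open>Y\<close> can be put first in the join, where it only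
  replaces \<open>a\<close> by \<open>A a b = a\<close>.\<close>

lemma scene_Join_Un_agree:
  assumes "scene_basis S" "X \<subseteq> set S" "Y \<subseteq> set S" "\<And>A. A \<in> Y \<Longrightarrow> a \<approx> b on A"
  shows "scene_Join (X \<union> Y) a b = scene_Join X a b"
proof -
  have "finite Y"
    using assms(3) finite_subset by blast
  then show ?thesis
    using assms(3,4)
  proof (induction Y)
    case empty
    show ?case by simp
  next
    case (insert A Y)
    then have "A a b = a"
      by (simp add: agree_on_def)
    then show ?case
      using insert assms(2) by (simp add: scene_Join_insert [OF assms(1)] scene_join_def)
  qed
qed

text \<open>\<open>A\<close> is moved past the factors one at a time; \<open>A \<notin> X\<close>
  makes each of them differ from \<open>A\<close>, hence independent of it.\<close>

lemma scene_indep_Join: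
  assumes "scene_basis S" "X \<subseteq> set S" "A \<in> set S" "A \<notin> X"
  shows "scene_indep (scene_Join X) A"
proof -
  have "finite X"
    using assms(2) finite_subset by blast
  then show ?thesis
    using assms(2,4)
  proof (induction X)
    case empty
    show ?case by (simp add: scene_indep_def scene_bot_def)
  next
    case (insert B X)
    then have "scene_indep B A" "scene_indep (scene_Join X) A"
      using scene_basis_indep [OF assms(1)] assms(3) by auto
    then show ?case
      using insert.prems by (simp add: scene_Join_insert [OF assms(1)] scene_join_def scene_indep_def)
  qed
qed

theorem lemma38:
  fixes S :: "'s merge list" and P :: "'s \<Rightarrow> 's \<Rightarrow> bool"
  assumes "scene_basis S"
  shows "(\<forall>s s'. P s s' \<longrightarrow> s \<approx> s' on scene_compl (scene_Join (bound_vars S P))) \<and>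
    (\<forall>T. T \<subseteq> set S \<longrightarrow>
       (\<forall>s s'. P s s' \<longrightarrow> s \<approx> s' on scene_compl (scene_Join T)) \<longrightarrow>
       bound_vars S P \<subseteq> T)"
proof (intro conjI allI impI)
  have scene: "scene A" if "A \<in> set S" for A
    using assms that by (simp add: scene_basis_def)
  show "s \<approx> s' on scene_compl (scene_Join (bound_vars S P))" if "P s s'" for s s'
  proof -
    let ?BV = "bound_vars S P"
    have sub: "?BV \<subseteq> set S"
      by (auto simp: bound_vars_def)
    \<comment> \<open>The states are swapped because the complement evaluates the join at
      \<open>s' s\<close>.\<close>
    have "s' \<approx> s on A" if "A \<in> set S - ?BV" for A
      using that \<open>P s s'\<close> agree_on_sym [OF scene, of A s s'] by (auto simp: bound_vars_def)
    then have "scene_Join ?BV s' s = scene_Join (?BV \<union> (set S - ?BV)) s' s"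
      by (intro scene_Join_Un_agree [OF assms sub, symmetric]) auto
    also have "?BV \<union> (set S - ?BV) = set S"
      using sub by blast
    finally show ?thesis
      by (simp add: scene_Join_basis [OF assms] scene_top_def agree_on_def scene_compl_def)
  qed
  show "bound_vars S P \<subseteq> T"
    if T: "T \<subseteq> set S" "\<forall>s s'. P s s' \<longrightarrow> s \<approx> s' on scene_compl (scene_Join T)" for T
  proof
    fix x assume "x \<in> bound_vars S P"
    then obtain s s' where x: "x \<in> set S" and P: "P s s'" and neq: "x s s' \<noteq> s"
      by (auto simp: bound_vars_def agree_on_def)
    have eq: "scene_Join T s' s = s"
      using T(2) P by (simp add: agree_on_def scene_compl_def)
    show "x \<in> T"
    proof (rule ccontr)
      assume "x \<notin> T"
      \<comment> \<open>Independence is used with \<open>s'\<close> as both first and third state,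
        so that \<open>x\<close> meets equal arguments on the right.\<close>
      then have "x (scene_Join T s' s) s' = scene_Join T (x s' s') s"
        using scene_indep_Join [OF assms T(1) x] by (simp add: scene_indep_def)
      also have "x s' s' = s'"
        using scene [OF x] by (simp add: scene_def)
      finally show False
        using neq eq by simp
    qed
  qed
qed

end
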